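(* Let $m$ be a positive integer and let $M,\Lambda_1,\dots,\Lambda_{m-1}$ be real numbers. Let $F(z)=\sum_{k=0}^{m-1}\bar z^k f_k(z)$ be a poly-analytic function of order $m$ on $\mathbb{D}$, where all $f_k$ are holomorphic on $\mathbb{D}$, satisfying $f_k(0)=0$ for $k\in\{0,1,\dots,m-1\}$ and $F_z(0)=1$. Suppose that $|f_0(z)|<M$ and $|f_k'(z)|\le\Lambda_k$ for $k\in\{1,\dots,m-1\}$, for all $z\in\mathbb{D}$. Let $r_2$ be the unique root in $(0,1)$ of the equation $$1-\left(M-\frac1M\right)\frac{2r-r^2}{(1-r)^2}-\sum_{k=1}^{m-1}(k+1)r^k\Lambda_k=0.$$ Then for each $\rho_2\in(0,r_2)$, the function $F$ is bi-Lipschitz on $\overline{\mathbb{D}}_{\rho_2}$; namely, with $$l_2=1-\left(M-\frac1M\right)\frac{2\rho_2-\rho_2^2}{(1-\rho_2)^2}-\sum_{k=1}^{m-1}(k+1)\rho_2^k\Lambda_k,\qquad L_2=\frac{M}{1-\rho_2^2}+\sum_{k=1}^{m-1}\rho_2^k(k+1)\Lambda_k,$$ one has $l_2>0$ and $$l_2|z_1-z_2|\le|F(z_1)-F(z_2)|\le L_2|z_1-z_2|\quad\text{for all } z_1,z_2\in\overline{\mathbb{D}}_{\rho_2}.$$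
   Context: $\mathbb{D}=\{z\in\mathbb{C}:|z|<1\}$, $\mathbb{D}_r=\{z\in\mathbb{C}:|z|<r\}$, and $\overline{\mathbb{D}}_r$ is its closure. A complex-valued $C^m$ function $F$ on a domain is poly-analytic of order $m\ge1$ if $\partial^m F/\partial\bar z^m=0$; equivalently $F(z)=\sum_{k=0}^{m-1}\bar z^k f_k(z)$ with $f_k$ analytic. $F_z=\partial F/\partial z$ is the Wirtinger derivative. A map $g$ on $\Omega\subset\mathbb{C}$ is bi-Lipschitz if there are constants $l,L>0$ with $l|z_1-z_2|\le|g(z_1)-g(z_2)|\le L|z_1-z_2|$ for all $z_1,z_2\in\Omega$. Empty sums are $0$.
   Formalization: The root r_2 in (0,1) exists exactly when M>1 or the sum of (k+1)Λ_k over k=1,…,m-1 exceeds 1 (for F(z)=z, m=1, M=1 the equation reads 1=0); its existence is asserted only then, and the rest is asserted whenever r_2 exists. *)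

theory Defs
  imports "HOL-Complex_Analysis.Complex_Analysis"
begin

text \<open>The Wirtinger derivative \<open>\<partial>F/\<partial>z = (F\<^sub>x - \<i> F\<^sub>y) / 2\<close>, where \<open>z = x + \<i> y\<close>.\<close>

definition wirtinger_z :: "(complex \<Rightarrow> complex) \<Rightarrow> complex \<Rightarrow> complex" where
  "wirtinger_z F z =
     (vector_derivative (\<lambda>x. F (Complex x (Im z))) (at (Re z))
      - \<i> * vector_derivative (\<lambda>y. F (Complex (Re z) y)) (at (Im z))) / 2"

lemma wirtinger_z_eq_deriv:
  assumes "F field_differentiable at z"
  shows "wirtinger_z F z = deriv F z"
proof -
  have D: "(F has_field_derivative deriv F z) (at z)"
    using assms by (simp add: field_differentiable_derivI)
  have X: "((\<lambda>x. Complex x (Im z)) has_vector_derivative 1) (at (Re z))"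
    unfolding Complex_eq by (auto intro!: derivative_eq_intros)
  have Y: "((\<lambda>y. Complex (Re z) y) has_vector_derivative \<i>) (at (Im z))"
    unfolding Complex_eq by (auto intro!: derivative_eq_intros)
  have "((\<lambda>x. F (Complex x (Im z))) has_vector_derivative deriv F z) (at (Re z))"
    using field_vector_diff_chain_at[OF X, of F "deriv F z"] D by (simp add: o_def)
  moreover have "((\<lambda>y. F (Complex (Re z) y)) has_vector_derivative \<i> * deriv F z) (at (Im z))"
    using field_vector_diff_chain_at[OF Y, of F "deriv F z"] D by (simp add: o_def)
  ultimately show ?thesis
    unfolding wirtinger_z_def by (simp add: vector_derivative_at mult.assoc[symmetric])
qed

definition bi_lipschitz_on :: "complex set \<Rightarrow> (complex \<Rightarrow> complex) \<Rightarrow> bool" where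
  "bi_lipschitz_on \<Omega> g \<longleftrightarrow>
     (\<exists>l L. l > 0 \<and> L > 0 \<and>
        (\<forall>z1\<in>\<Omega>. \<forall>z2\<in>\<Omega>. l * cmod (z1 - z2) \<le> cmod (g z1 - g z2)
                          \<and> cmod (g z1 - g z2) \<le> L * cmod (z1 - z2)))"

text \<open>
  The number \<open>r\<^sub>2\<close> is the zero of \<open>lower_const m M \<Lambda>\<close> in \<open>(0,1)\<close>, and
  \<open>l\<^sub>2 = lower_const m M \<Lambda> \<rho>\<^sub>2\<close>, \<open>L\<^sub>2 = upper_const m M \<Lambda> \<rho>\<^sub>2\<close>. Only the values
  \<open>\<Lambda> 1, \<dots>, \<Lambda> (m - 1)\<close> are used.
\<close>

definition lower_const :: "nat \<Rightarrow> real \<Rightarrow> (nat \<Rightarrow> real) \<Rightarrow> real \<Rightarrow> real" where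
  "lower_const m M \<Lambda> r =
     1 - (M - 1 / M) * ((2 * r - r^2) / (1 - r)^2)
       - (\<Sum>k\<in>{1..<m}. real (k + 1) * r ^ k * \<Lambda> k)"

definition upper_const :: "nat \<Rightarrow> real \<Rightarrow> (nat \<Rightarrow> real) \<Rightarrow> real \<Rightarrow> real" where
  "upper_const m M \<Lambda> r =
     M / (1 - r^2) + (\<Sum>k\<in>{1..<m}. r ^ k * real (k + 1) * \<Lambda> k)"

end

theory Submission
  imports Defs
begin

text \<open>
  Along a segment in the closed disc of radius \<open>\<rho>\<close>, the map \<open>F - id\<close> has a differential of
  norm at most \<open>\<bar>F\<^sub>z - 1\<bar> + \<bar>F\<^bsub>cnj z\<^esub>\<bar>\<close>. The terms with \<open>k \<ge> 1\<close> are controlled by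
  \<open>\<bar>f\<^sub>k z\<bar> \<le> \<Lambda>\<^sub>k \<bar>z\<bar>\<close>. For the analytic part write \<open>f\<^sub>0 z = M z h z\<close>, where \<open>h\<close> maps
  the disc into itself and \<open>h 0 = 1/M\<close>: the Schwarz--Pick lemma, applied to \<open>h\<close> and to its
  Moebius normalisation at \<open>0\<close>, bounds \<open>M (\<bar>h z - h 0\<bar> + \<bar>z h' z\<bar>)\<close> by
  \<open>(M - 1/M) (r/(1-r) + r/(1-r)\<^sup>2)\<close>, which is the required term without any use of Taylor
  coefficients. Finally \<open>(1 - l(r))/r\<close> is nondecreasing, so \<open>l\<close> is positive before a root.
\<close>

subsection \<open>Schwarz--Pick estimates\<close>

lemma norm_one_minus_cnj_mult_ge:
  "1 - cmod w * cmod z \<le> cmod (1 - cnj w * z)"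
  using norm_triangle_ineq2[of 1 "cnj w * z"] by (simp add: norm_mult)

lemma one_minus_cnj_mult_nonzero:
  assumes "cmod w < 1" "cmod z < 1"
  shows "1 - cnj w * z \<noteq> 0"
proof -
  have "cmod w * cmod z < 1"
    using assms by (metis mult_less_cancel_right2 mult_le_one norm_ge_zero less_eq_real_def
        mult_strict_mono' mult_1)
  then show ?thesis
    using norm_one_minus_cnj_mult_ge[of w z] by fastforce
qed

text \<open>In the quotient rule the terms linear in \<open>z\<close> cancel, leaving the constant
  numerator \<open>1 - w * cnj w\<close>.\<close>

lemma has_field_derivative_Moebius_function:
  assumes "cmod w < 1" "cmod z < 1"
  shows "(Moebius_function 0 w has_field_derivative
           (1 - of_real ((cmod w)\<^sup>2)) / (1 - cnj w * z)\<^sup>2) (at z)"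
proof -
  have eq: "Moebius_function 0 w = (\<lambda>z. (z - w) / (1 - cnj w * z))"
    by (simp add: fun_eq_iff Moebius_function_simple)
  have nz: "1 - cnj w * z \<noteq> 0"
    using assms by (rule one_minus_cnj_mult_nonzero)
  have "((\<lambda>z. (z - w) / (1 - cnj w * z)) has_field_derivative
          ((1 - cnj w * z) - (z - w) * (- cnj w)) / ((1 - cnj w * z) * (1 - cnj w * z))) (at z)"
    using nz by (auto intro!: derivative_eq_intros)
  moreover have "(1 - cnj w * z) - (z - w) * (- cnj w) = 1 - of_real ((cmod w)\<^sup>2)"
    by (simp only: complex_norm_square) (simp add: algebra_simps)
  ultimately show ?thesis
    unfolding eq by (simp only: power2_eq_square[of "1 - cnj w * z"])
qed

lemma Moebius_function_comp_holomorphic: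
  assumes "f holomorphic_on ball 0 1" "f ` ball 0 1 \<subseteq> ball 0 1" "cmod w < 1"
  shows "(\<lambda>z. Moebius_function 0 w (f z)) holomorphic_on ball 0 1"
  using holomorphic_on_compose_gen[OF assms(1) Moebius_function_holomorphic[OF assms(3)] assms(2)]
  by (simp add: o_def)

text \<open>Disc automorphisms move both base points to the origin: \<open>p\<close> sends 0 to
  \<open>w\<close> and \<open>q\<close> sends \<open>f w\<close> to 0. The Schwarz lemma bounds the
  derivative of the composite \<open>q (f (p z))\<close> at 0 by 1, and the chain rule turns this
  into the estimate for \<open>f\<close>.\<close>

lemma Schwarz_Pick_deriv:
  assumes holf: "f holomorphic_on ball 0 1"
    and f1: "\<And>z. cmod z < 1 \<Longrightarrow> cmod (f z) < 1"
    and w: "cmod w < 1"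
  shows "cmod (deriv f w) \<le> (1 - (cmod (f w))\<^sup>2) / (1 - (cmod w)\<^sup>2)"
proof -
  define p where "p = Moebius_function 0 (- w)"
  define q where "q = Moebius_function 0 (f w)"
  have p1: "cmod (p z) < 1" if "cmod z < 1" for z
    using Moebius_function_norm_lt_1[of "- w" z] w that by (simp add: p_def)
  have p0: "p 0 = w"
    by (simp add: p_def Moebius_function_of_zero)
  have "(\<lambda>z. f (p z)) holomorphic_on ball 0 1"
    using holomorphic_on_compose_gen[OF Moebius_function_holomorphic[of "- w" 0] holf] w p1
    by (auto simp: o_def p_def image_subset_iff)
  then have hol: "(\<lambda>z. q (f (p z))) holomorphic_on ball 0 1"
    unfolding q_def by (rule Moebius_function_comp_holomorphic) (use f1 p1 w in auto)
  have le1: "cmod (deriv (\<lambda>z. q (f (p z))) 0) \<le> 1"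
  proof (rule Schwarz_Lemma(2)[OF hol])
    show "cmod (q (f (p z))) < 1" if "cmod z < 1" for z
      unfolding q_def using that by (intro Moebius_function_norm_lt_1 f1 p1 w)
    show "cmod 0 < 1" by simp
  qed (simp add: p0 q_def Moebius_function_eq_zero)
  have dp: "(p has_field_derivative (1 - of_real ((cmod w)\<^sup>2))) (at 0)"
    using has_field_derivative_Moebius_function[of "- w" 0] w by (simp add: p_def)
  have df: "(f has_field_derivative deriv f w) (at (p 0))"
    unfolding p0 using holomorphic_derivI[OF holf, of w] w by simp
  have "(q has_field_derivative
          (1 - of_real ((cmod (f w))\<^sup>2)) / (1 - cnj (f w) * f w)\<^sup>2) (at (f (p 0)))"
    unfolding q_def p0 by (rule has_field_derivative_Moebius_function) (use f1 w in auto)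
  from DERIV_chain2[OF this DERIV_chain2[OF df dp]]
  have "deriv (\<lambda>z. q (f (p z))) 0 =
          (1 - of_real ((cmod (f w))\<^sup>2)) / (1 - cnj (f w) * f w)\<^sup>2 *
          (deriv f w * (1 - of_real ((cmod w)\<^sup>2)))"
    by (rule DERIV_imp_deriv)
  \<comment> \<open>This quantity is real, so the whole chain-rule factor is a positive real
    multiple of \<open>deriv f w\<close> and its norm can be read off.\<close>
  also have "1 - cnj (f w) * f w = of_real (1 - (cmod (f w))\<^sup>2)"
    using complex_norm_square[of "f w"] by (simp add: mult.commute)
  finally have eq: "deriv (\<lambda>z. q (f (p z))) 0 =
      of_real ((1 - (cmod (f w))\<^sup>2) / (1 - (cmod (f w))\<^sup>2)\<^sup>2 * (1 - (cmod w)\<^sup>2)) * deriv f w"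
    by simp
  have pos: "0 < 1 - (cmod (f w))\<^sup>2" "0 < 1 - (cmod w)\<^sup>2"
    using f1[OF w] w by (simp_all add: power_less_one_iff abs_square_less_1)
  have "(1 - (cmod w)\<^sup>2) / (1 - (cmod (f w))\<^sup>2) * cmod (deriv f w) \<le> 1"
    using le1 pos unfolding eq norm_mult norm_of_real
    by (simp add: power2_eq_square[of "1 - _"] abs_mult)
  then show ?thesis
    using pos by (simp add: field_simps)
qed

text \<open>Composing with the automorphism that sends \<open>h 0\<close> to 0 gives a map
  \<open>p\<close> fixing the origin, for which the Schwarz lemma yields
  \<open>cmod (p z) \<le> cmod z\<close>. Writing \<open>h\<close> in terms of \<open>p\<close> by
  the inverse automorphism produces the factor \<open>1 - (cmod (h 0))\<^sup>2\<close> in both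
  bounds.\<close>

lemma Schwarz_Pick_growth:
  assumes holh: "h holomorphic_on ball 0 1"
    and h1: "\<And>z. cmod z < 1 \<Longrightarrow> cmod (h z) < 1"
    and z: "cmod z < 1"
  shows "cmod (h z - h 0) \<le> (1 - (cmod (h 0))\<^sup>2) * (cmod z / (1 - cmod z))"
    and "cmod (deriv h z) \<le> (1 - (cmod (h 0))\<^sup>2) / (1 - cmod z)\<^sup>2"
proof -
  define a where "a = h 0"
  define p where "p = (\<lambda>z. Moebius_function 0 a (h z))"
  have a1: "cmod a < 1"
    unfolding a_def by (rule h1) simp
  then have a2: "0 < 1 - (cmod a)\<^sup>2"
    by (simp add: abs_square_less_1)
  have holp: "p holomorphic_on ball 0 1"
    unfolding p_def by (rule Moebius_function_comp_holomorphic) (use holh h1 a1 in auto)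
  have p1: "cmod (p u) < 1" if "cmod u < 1" for u
    unfolding p_def by (intro Moebius_function_norm_lt_1 a1 h1 that)
  have p0: "p 0 = 0"
    by (simp add: p_def a_def Moebius_function_eq_zero)
  have hp: "h u = Moebius_function 0 (- a) (p u)" if "cmod u < 1" for u
    unfolding p_def using Moebius_function_compose[of "- a" a "h u"] a1 h1[OF that] by simp
  define t where "t = cmod (p z)"
  define r where "r = cmod z"
  have tr: "t \<le> r" "0 \<le> t" "r < 1"
    using Schwarz_Lemma(1)[OF holp p0 p1 z] z by (auto simp: t_def r_def)
  \<comment> \<open>Replacing \<open>cmod a\<close> by 1 makes the lower bound for the denominator
    independent of \<open>h 0\<close>.\<close>
  have den: "1 - t \<le> cmod (1 + cnj a * p z)"
    using norm_one_minus_cnj_mult_ge[of "- a" "p z"] a1 tr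
      mult_right_le_one_le[of t "cmod a"] by (simp add: t_def mult.commute)
  have nz: "1 + cnj a * p z \<noteq> 0"
    using den tr by auto
  have "h z - h 0 = (p z + a) / (1 + cnj a * p z) - a"
    using hp[OF z] by (simp add: Moebius_function_simple a_def)
  also have "\<dots> = p z * (1 - a * cnj a) / (1 + cnj a * p z)"
    using nz by (simp add: field_simps)
  also have "1 - a * cnj a = of_real (1 - (cmod a)\<^sup>2)"
    using complex_norm_square[of a] by simp
  finally have "cmod (h z - h 0) = t * (1 - (cmod a)\<^sup>2) / cmod (1 + cnj a * p z)"
    using a2 by (simp only: norm_mult norm_divide norm_of_real t_def abs_of_pos)
  also have "\<dots> \<le> r * (1 - (cmod a)\<^sup>2) / (1 - r)"
    using den tr a2 by (intro frac_le mult_right_mono mult_nonneg_nonneg) auto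
  finally show "cmod (h z - h 0) \<le> (1 - (cmod (h 0))\<^sup>2) * (cmod z / (1 - cmod z))"
    by (simp add: a_def r_def mult.commute)
  have dM: "(Moebius_function 0 (- a) has_field_derivative
      (1 - of_real ((cmod a)\<^sup>2)) / (1 + cnj a * p z)\<^sup>2) (at (p z))"
    using has_field_derivative_Moebius_function[of "- a" "p z"] a1 p1[OF z] by simp
  have "((\<lambda>u. Moebius_function 0 (- a) (p u)) has_field_derivative
      (1 - of_real ((cmod a)\<^sup>2)) / (1 + cnj a * p z)\<^sup>2 * deriv p z) (at z)"
    by (rule DERIV_chain2[where f = "Moebius_function 0 (- a)" and g = p, OF dM])
      (use holomorphic_derivI[OF holp, of z] z in simp)
  then have "(h has_field_derivative
      (1 - of_real ((cmod a)\<^sup>2)) / (1 + cnj a * p z)\<^sup>2 * deriv p z) (at z)"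
    by (rule has_field_derivative_transform_within_open[of _ _ _ "ball 0 1"]) (use z hp in auto)
  then have "deriv h z = of_real (1 - (cmod a)\<^sup>2) / (1 + cnj a * p z)\<^sup>2 * deriv p z"
    by (simp add: DERIV_imp_deriv)
  then have "cmod (deriv h z) = (1 - (cmod a)\<^sup>2) / (cmod (1 + cnj a * p z))\<^sup>2 * cmod (deriv p z)"
    using a2 by (simp only: norm_mult norm_divide norm_power norm_of_real abs_of_pos)
  also have "\<dots> \<le> (1 - (cmod a)\<^sup>2) / (1 - t)\<^sup>2 * ((1 - t\<^sup>2) / (1 - r\<^sup>2))"
  proof (rule mult_mono)
    show "(1 - (cmod a)\<^sup>2) / (cmod (1 + cnj a * p z))\<^sup>2 \<le> (1 - (cmod a)\<^sup>2) / (1 - t)\<^sup>2"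
      using den tr a2 by (intro divide_left_mono power_mono mult_pos_pos zero_less_power) auto
    show "cmod (deriv p z) \<le> (1 - t\<^sup>2) / (1 - r\<^sup>2)"
      unfolding t_def r_def by (rule Schwarz_Pick_deriv[OF holp p1 z])
  qed (use a2 in auto)
  also have "\<dots> = (1 - (cmod a)\<^sup>2) * (((1 + t) / (1 + r)) / ((1 - t) * (1 - r)))"
  proof -
    have "1 - t\<^sup>2 = (1 - t) * (1 + t)" "1 - r\<^sup>2 = (1 - r) * (1 + r)"
      by (simp_all add: power2_eq_square algebra_simps)
    then show ?thesis
      using tr by (simp add: power2_eq_square)
  qed
  \<comment> \<open>Both factors use \<open>t \<le> r\<close>: the quotient of \<open>1 + t\<close>
    by \<open>1 + r\<close> is at most 1, and \<open>1 - t\<close> is at least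
    \<open>1 - r\<close>.\<close>
  also have "\<dots> \<le> (1 - (cmod a)\<^sup>2) * (1 / ((1 - r) * (1 - r)))"
    using tr a2 by (intro mult_left_mono frac_le mult_right_mono) auto
  finally show "cmod (deriv h z) \<le> (1 - (cmod (h 0))\<^sup>2) / (1 - cmod z)\<^sup>2"
    by (simp add: a_def r_def power2_eq_square)
qed

subsection \<open>Bounded analytic functions with normalised derivative\<close>

lemma deriv_cdivide_holomorphic:
  assumes "g holomorphic_on S" "open S" "z \<in> S"
  shows "deriv (\<lambda>z. g z / c) z = deriv g z / c"
  by (rule DERIV_imp_deriv[OF DERIV_cdivide[OF holomorphic_derivI[OF assms]]])

text \<open>The Schwarz lemma for \<open>g / M\<close> bounds its derivative at 0, which is
  \<open>1 / M\<close>, by 1.\<close>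

lemma bounded_normalised_ge_1:
  assumes "g holomorphic_on ball 0 1" "g 0 = 0" "deriv g 0 = 1"
    and "\<And>z. cmod z < 1 \<Longrightarrow> cmod (g z) < M"
  shows "M \<ge> 1"
proof -
  have M: "0 < M"
    using assms(4)[of 0] assms(2) by simp
  have "cmod (deriv (\<lambda>z. g z / of_real M) 0) \<le> 1"
  proof (rule Schwarz_Lemma(2)[where \<xi> = 0])
    show "(\<lambda>z. g z / of_real M) holomorphic_on ball 0 1"
      using assms(1) M by (intro holomorphic_intros) auto
  qed (use assms M in \<open>auto simp: norm_divide\<close>)
  also have "deriv (\<lambda>z. g z / of_real M) 0 = 1 / of_real M"
    using deriv_cdivide_holomorphic[OF assms(1), of 0] assms(3) by simp
  finally show ?thesis
    using M by (simp add: norm_divide)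
qed

text \<open>Schwarz--Pick for \<open>g / M\<close>, with the numerator estimated by 1. This supplies
  the first term of \<open>upper_const\<close>.\<close>

lemma bounded_deriv_le:
  assumes "g holomorphic_on ball 0 1"
    and "\<And>z. cmod z < 1 \<Longrightarrow> cmod (g z) < M" "cmod z < 1"
  shows "cmod (deriv g z) \<le> M / (1 - (cmod z)\<^sup>2)"
proof -
  have M: "0 < M"
    using assms(2)[OF assms(3)] by (meson le_less_trans norm_ge_zero)
  have "cmod (deriv (\<lambda>z. g z / of_real M) z)
      \<le> (1 - (cmod (g z / of_real M))\<^sup>2) / (1 - (cmod z)\<^sup>2)"
  proof (rule Schwarz_Pick_deriv)
    show "(\<lambda>z. g z / of_real M) holomorphic_on ball 0 1"
      using assms(1) M by (intro holomorphic_intros) auto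
  qed (use assms M in \<open>auto simp: norm_divide\<close>)
  also have "\<dots> \<le> 1 / (1 - (cmod z)\<^sup>2)"
    using assms(3) by (intro divide_right_mono) (auto simp: abs_square_le_1)
  also have "deriv (\<lambda>z. g z / of_real M) z = deriv g z / of_real M"
    using deriv_cdivide_holomorphic[OF assms(1), of z] assms(3) by simp
  finally show ?thesis
    using M by (simp add: norm_divide field_simps)
qed

text \<open>The split \<open>2 * r - r\<^sup>2 = r * (1 - r) + r\<close> matches the two growth
  bounds for \<open>h\<close> and \<open>h'\<close>, and shows that the quotient is \<open>r\<close>
  times an increasing function on \<open>0 \<le> r < 1\<close>.\<close>

lemma Koebe_quotient_eq:
  assumes "r < (1::real)"
  shows "(2 * r - r\<^sup>2) / (1 - r)\<^sup>2 = r * (1 / (1 - r) + 1 / (1 - r)\<^sup>2)"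
proof -
  have "r / (1 - r) = r * (1 - r) / (1 - r)\<^sup>2"
    using assms by (simp add: power2_eq_square)
  then show ?thesis
    by (simp add: distrib_left add_divide_distrib[symmetric])
      (simp add: power2_eq_square algebra_simps)
qed

text \<open>The factor \<open>M - 1 / M\<close> is \<open>M * (1 - (cmod (h 0))\<^sup>2)\<close>
  with \<open>h 0 = 1 / M\<close>. The case \<open>M = 1\<close> is separate because
  \<open>h\<close> would then have modulus 1 at the origin; there the equality case of the Schwarz
  lemma makes \<open>g\<close> the identity on the disc, and both sides vanish.\<close>

lemma bounded_normalised_deriv_diff_le:
  assumes holg: "g holomorphic_on ball 0 1" and g0: "g 0 = 0" and dg: "deriv g 0 = 1"
    and gM: "\<And>z. cmod z < 1 \<Longrightarrow> cmod (g z) < M" and z: "cmod z < 1"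
  shows "cmod (deriv g z - 1) \<le>
           (M - 1 / M) * ((2 * cmod z - (cmod z)\<^sup>2) / (1 - cmod z)\<^sup>2)"
proof -
  have M: "M \<ge> 1"
    by (rule bounded_normalised_ge_1[OF holg g0 dg gM])
  define k where "k = (\<lambda>z. g z / of_real M)"
  have holk: "k holomorphic_on ball 0 1"
    unfolding k_def using holg M by (intro holomorphic_intros) auto
  have k0: "k 0 = 0"
    by (simp add: k_def g0)
  have k1: "cmod (k u) < 1" if "cmod u < 1" for u
    using gM[OF that] M by (simp add: k_def norm_divide)
  have dk: "deriv k 0 = 1 / of_real M"
    unfolding k_def using deriv_cdivide_holomorphic[OF holg, of 0] dg by simp
  show ?thesis
  proof (cases "M = 1")
    case True
    then obtain \<alpha> where \<alpha>: "\<And>u. cmod u < 1 \<Longrightarrow> g u = \<alpha> * u"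
      using Schwarz_Lemma(3)[OF holk k0 k1 z] dk by (auto simp: k_def)
    have d: "deriv g u = \<alpha>" if "cmod u < 1" for u
    proof -
      have "((*) \<alpha> has_field_derivative \<alpha>) (at u)"
        by (auto intro!: derivative_eq_intros)
      then have "(g has_field_derivative \<alpha>) (at u)"
        by (rule has_field_derivative_transform_within_open[of _ _ _ "ball 0 1"]) (use that \<alpha> in auto)
      then show ?thesis
        by (rule DERIV_imp_deriv)
    qed
    show ?thesis
      using d[OF z] d[of 0] dg True by simp
  next
    case False
    then have M1: "M > 1"
      using M by simp
    obtain h where holh: "h holomorphic_on ball 0 1"
      and kh: "\<And>u. cmod u < 1 \<Longrightarrow> k u = u * h u" and dh: "deriv k 0 = h 0"
      using Schwarz3[OF holk k0] by blast
    have h0: "h 0 = of_real (1 / M)"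
      using dk dh by simp
    have h1: "cmod (h u) < 1" if u: "cmod u < 1" for u
    proof (cases "u = 0")
      case True
      then show ?thesis
        using M1 h0 by (simp add: norm_divide)
    next
      case nz: False
      \<comment> \<open>Equality would make \<open>k\<close> a rotation, with derivative of modulus
        1 at 0, whereas that derivative is \<open>1 / M < 1\<close>.\<close>
      have "cmod (k u) \<noteq> cmod u"
      proof
        assume "cmod (k u) = cmod u"
        then obtain \<alpha> where \<alpha>: "\<And>u. cmod u < 1 \<Longrightarrow> k u = \<alpha> * u" "cmod \<alpha> = 1"
          using Schwarz_Lemma(3)[OF holk k0 k1 z] nz u by blast
        have "((*) \<alpha> has_field_derivative \<alpha>) (at 0)"
          by (auto intro!: derivative_eq_intros)
        then have "(k has_field_derivative \<alpha>) (at 0)"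
          by (rule has_field_derivative_transform_within_open[of _ _ _ "ball 0 1"]) (use \<alpha> in auto)
        then have "cmod (1 / of_real M) = 1"
          using \<alpha>(2) dk DERIV_imp_deriv by fastforce
        then show False
          using M1 by (simp add: norm_divide)
      qed
      then have "cmod (k u) < cmod u"
        using Schwarz_Lemma(1)[OF holk k0 k1 u] by simp
      then show ?thesis
        using kh[OF u] nz by (simp add: norm_mult)
    qed
    define r where "r = cmod z"
    have r: "0 \<le> r" "r < 1"
      using z by (auto simp: r_def)
    have "((\<lambda>u. of_real M * (u * h u)) has_field_derivative
            of_real M * (h z + z * deriv h z)) (at z)"
      using holomorphic_derivI[OF holh, of z] z
      by (auto intro!: derivative_eq_intros simp: algebra_simps)
    then have "(g has_field_derivative of_real M * (h z + z * deriv h z)) (at z)"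
      by (rule has_field_derivative_transform_within_open[of _ _ _ "ball 0 1"])
        (use z kh M1 in \<open>auto simp: k_def field_simps\<close>)
    then have "deriv g z - 1 = of_real M * (h z + z * deriv h z) - 1"
      by (simp add: DERIV_imp_deriv)
    \<comment> \<open>The subtracted 1 is absorbed as \<open>M * h 0\<close>.\<close>
    also have "\<dots> = of_real M * ((h z - h 0) + z * deriv h z)"
      using M1 by (simp add: h0 field_simps)
    finally have "cmod (deriv g z - 1) = M * cmod ((h z - h 0) + z * deriv h z)"
      using M1 by (simp add: norm_mult)
    also have "\<dots> \<le> M * ((1 - (cmod (h 0))\<^sup>2) * (r / (1 - r))
                          + r * ((1 - (cmod (h 0))\<^sup>2) / (1 - r)\<^sup>2))"
    proof (intro mult_left_mono norm_triangle_le add_mono)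
      show "cmod (h z - h 0) \<le> (1 - (cmod (h 0))\<^sup>2) * (r / (1 - r))"
        unfolding r_def by (rule Schwarz_Pick_growth(1)[OF holh h1 z])
      show "cmod (z * deriv h z) \<le> r * ((1 - (cmod (h 0))\<^sup>2) / (1 - r)\<^sup>2)"
        unfolding r_def norm_mult
        by (intro mult_left_mono Schwarz_Pick_growth(2)[OF holh h1 z]) auto
    qed (use M1 in simp)
    also have "\<dots> = M * (1 - (cmod (h 0))\<^sup>2) * (r / (1 - r) + r / (1 - r)\<^sup>2)"
      by (simp add: distrib_left mult_ac)
    also have "M * (1 - (cmod (h 0))\<^sup>2) = M - 1 / M"
      using M1 by (simp add: h0 norm_divide power2_eq_square field_simps)
    also have "r / (1 - r) + r / (1 - r)\<^sup>2 = (2 * r - r\<^sup>2) / (1 - r)\<^sup>2"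
      using r by (simp add: Koebe_quotient_eq distrib_left)
    finally show ?thesis
      by (simp add: r_def)
  qed
qed

subsection \<open>Poly-analytic functions\<close>

text \<open>The derivative is the real Frechet one: the first part of each summand is complex linear
  in \<open>h\<close>, the second conjugate linear. At \<open>k = 0\<close> the truncated exponent
  \<open>k - 1\<close> is harmless, since the factor \<open>of_nat k\<close> is zero.\<close>

lemma has_derivative_polyanalytic:
  assumes "\<And>k. k < m \<Longrightarrow> f k holomorphic_on ball 0 1"
    and "\<And>z. z \<in> ball 0 1 \<Longrightarrow> F z = (\<Sum>k<m. cnj z ^ k * f k z)"
    and "z \<in> ball 0 1"
  shows "(F has_derivative
           (\<lambda>h. \<Sum>k<m. cnj z ^ k * (deriv (f k) z * h)
                         + of_nat k * cnj z ^ (k - 1) * cnj h * f k z)) (at z)"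
proof -
  have "((\<lambda>z. \<Sum>k<m. cnj z ^ k * f k z) has_derivative
           (\<lambda>h. \<Sum>k<m. cnj z ^ k * (deriv (f k) z * h)
                         + of_nat k * cnj z ^ (k - 1) * cnj h * f k z)) (at z)"
  proof (rule has_derivative_sum)
    fix k assume "k \<in> {..<m}"
    then have fk: "(f k has_derivative (\<lambda>h. deriv (f k) z * h)) (at z)"
      using holomorphic_derivI[OF assms(1), of k z] assms(3)
      by (simp add: has_field_derivative_def)
    have pw: "((\<lambda>z. cnj z ^ k) has_derivative
        (\<lambda>h. of_nat k * cnj h * cnj z ^ (k - 1))) (at z)"
      by (intro has_derivative_power bounded_linear_imp_has_derivative bounded_linear_cnj)
    from has_derivative_mult[OF pw fk] show "((\<lambda>z. cnj z ^ k * f k z) has_derivative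
        (\<lambda>h. cnj z ^ k * (deriv (f k) z * h)
                         + of_nat k * cnj z ^ (k - 1) * cnj h * f k z)) (at z)"
      by (simp only: mult_ac)
  qed
  then show ?thesis
    by (rule has_derivative_transform_within_open[of _ _ _ _ "ball 0 1"]) (use assms in auto)
qed

text \<open>Reads the Wirtinger derivative off a merely real-linear differential, as needed for the
  non-holomorphic \<open>F\<close>.\<close>

lemma wirtinger_z_has_derivative:
  assumes "(F has_derivative D) (at z)"
  shows "wirtinger_z F z = (D 1 - \<i> * D \<i>) / 2"
proof -
  have F: "(F has_derivative D) (at (Complex (Re z) (Im z)))"
    using assms by simp
  have X: "((\<lambda>x. Complex x (Im z)) has_derivative (\<lambda>h. of_real h)) (at (Re z))"
    unfolding Complex_eq by (auto intro!: derivative_eq_intros)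
  have Y: "((\<lambda>y. Complex (Re z) y) has_derivative (\<lambda>h. \<i> * of_real h)) (at (Im z))"
    unfolding Complex_eq by (auto intro!: derivative_eq_intros)
  have lin: "D (of_real h * u) = h *\<^sub>R D u" for h u
    using linear_scale[OF has_derivative_linear[OF assms], of h u] by (simp add: scaleR_conv_of_real)
  have "((\<lambda>x. F (Complex x (Im z))) has_vector_derivative D 1) (at (Re z))"
    using has_derivative_compose[OF X F] lin[of _ 1] by (simp add: has_vector_derivative_def)
  moreover have "((\<lambda>y. F (Complex (Re z) y)) has_vector_derivative D \<i>) (at (Im z))"
    using has_derivative_compose[OF Y F] lin[of _ \<i>]
    by (simp add: has_vector_derivative_def mult.commute)
  ultimately show ?thesis
    by (simp add: wirtinger_z_def vector_derivative_at)
qed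

text \<open>Translates the normalisation of \<open>F\<close> into one of \<open>f 0\<close>. At the
  origin the powers of \<open>cnj 0\<close> remove most terms; for \<open>k = 1\<close> the
  conjugate part carries \<open>0 ^ 0 = 1\<close> and vanishes because
  \<open>f 1 0 = 0\<close>.\<close>

lemma wirtinger_z_polyanalytic_0:
  assumes "m \<ge> 1" "\<And>k. k < m \<Longrightarrow> f k holomorphic_on ball 0 1"
    and "\<And>z. z \<in> ball 0 1 \<Longrightarrow> F z = (\<Sum>k<m. cnj z ^ k * f k z)"
    and "\<And>k. k < m \<Longrightarrow> f k 0 = 0"
  shows "wirtinger_z F 0 = deriv (f 0) 0"
proof -
  have "(\<Sum>k<m. cnj 0 ^ k * (deriv (f k) 0 * h) + of_nat k * cnj 0 ^ (k - 1) * cnj h * f k 0)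
          = deriv (f 0) 0 * h" for h
  proof -
    have "(\<Sum>k<m. cnj 0 ^ k * (deriv (f k) 0 * h) + of_nat k * cnj 0 ^ (k - 1) * cnj h * f k 0)
        = (\<Sum>k<m. if k = 0 then deriv (f 0) 0 * h else 0)"
      using assms(4) by (intro sum.cong) (auto simp: power_0_left)
    then show ?thesis
      using assms(1) by simp
  qed
  moreover have "(F has_derivative (\<lambda>h. \<Sum>k<m. cnj 0 ^ k * (deriv (f k) 0 * h)
                         + of_nat k * cnj 0 ^ (k - 1) * cnj h * f k 0)) (at 0)"
    by (rule has_derivative_polyanalytic[OF assms(2,3)]) auto
  ultimately have "(F has_derivative (\<lambda>h. deriv (f 0) 0 * h)) (at 0)"
    by presburger
  from wirtinger_z_has_derivative[OF this] show ?thesis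
    by (simp add: mult.left_commute[of "\<i>"])
qed

text \<open>The mean value inequality on the convex disc for \<open>F z - c * z\<close>. Keeping
  \<open>c\<close> free lets one estimate serve both sides: \<open>c = 1\<close> for the lower
  bound, \<open>c = 0\<close> for the upper one.\<close>

lemma polyanalytic_linearization_bound:
  assumes m: "m \<ge> 1" and hol: "\<And>k. k < m \<Longrightarrow> f k holomorphic_on ball 0 1"
    and F: "\<And>z. z \<in> ball 0 1 \<Longrightarrow> F z = (\<Sum>k<m. cnj z ^ k * f k z)"
    and f0: "\<And>k. k < m \<Longrightarrow> f k 0 = 0"
    and \<Lambda>: "\<And>k z. k \<in> {1..<m} \<Longrightarrow> z \<in> ball 0 1 \<Longrightarrow> cmod (deriv (f k) z) \<le> \<Lambda> k"
    and \<rho>: "\<rho> < 1"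
    and A: "\<And>z. z \<in> cball 0 \<rho> \<Longrightarrow> cmod (deriv (f 0) z - c) \<le> A"
    and z12: "z1 \<in> cball 0 \<rho>" "z2 \<in> cball 0 \<rho>"
  shows "cmod (F z1 - F z2 - c * (z1 - z2)) \<le>
           (A + (\<Sum>k\<in>{1..<m}. real (k + 1) * \<rho> ^ k * \<Lambda> k)) * cmod (z1 - z2)"
proof -
  define D where "D = (\<lambda>z h. \<Sum>k<m. cnj z ^ k * (deriv (f k) z * h)
                         + of_nat k * cnj z ^ (k - 1) * cnj h * f k z)"
  have sub: "z \<in> ball 0 1" if "z \<in> cball 0 \<rho>" for z :: complex
    using that \<rho> by auto
  have fk: "cmod (f k z) \<le> \<Lambda> k * cmod z" if k: "k \<in> {1..<m}" and z: "z \<in> ball 0 1" for k z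
  proof -
    have "cmod (f k z - f k 0) \<le> \<Lambda> k * cmod (z - 0)"
    proof (rule field_differentiable_bound[of "ball 0 1"])
      show "(f k has_field_derivative deriv (f k) u) (at u within ball 0 1)"
        if "u \<in> ball 0 1" for u
        using holomorphic_derivI[OF hol, of k u] k that by (auto intro: DERIV_subset)
    qed (use \<Lambda> k z in auto)
    then show ?thesis
      using f0 k by simp
  qed
  have "cmod ((F z1 - c * z1) - (F z2 - c * z2)) \<le>
           (A + (\<Sum>k\<in>{1..<m}. real (k + 1) * \<rho> ^ k * \<Lambda> k)) * cmod (z1 - z2)"
  proof (rule differentiable_bound[of "cball 0 \<rho>" _ "\<lambda>z h. D z h - c * h"])
    fix z :: complex assume z: "z \<in> cball 0 \<rho>"
    note zb = sub[OF z]
    have "(F has_derivative D z) (at z within cball 0 \<rho>)"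
      unfolding D_def
      by (rule has_derivative_at_withinI[OF has_derivative_polyanalytic[OF hol F zb]])
    then show "((\<lambda>z. F z - c * z) has_derivative (\<lambda>h. D z h - c * h)) (at z within cball 0 \<rho>)"
      by (auto intro!: derivative_eq_intros)
    show "onorm (\<lambda>h. D z h - c * h) \<le> A + (\<Sum>k\<in>{1..<m}. real (k + 1) * \<rho> ^ k * \<Lambda> k)"
    proof (rule onorm_le)
      fix h
      have zr: "cmod z \<le> \<rho>" "0 \<le> \<rho>"
        using z by (auto intro: order_trans[OF norm_ge_zero])
      have summand: "cmod (cnj z ^ k * (deriv (f k) z * h)
                    + of_nat k * cnj z ^ (k - 1) * cnj h * f k z)
                  \<le> real (k + 1) * \<rho> ^ k * \<Lambda> k * cmod h" if k: "k \<in> {1..<m}" for k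
      proof -
        have L: "0 \<le> \<Lambda> k"
          using \<Lambda>[OF k zb] by (rule order_trans[OF norm_ge_zero])
        have 1: "cmod (cnj z ^ k * (deriv (f k) z * h)) \<le> \<rho> ^ k * (\<Lambda> k * cmod h)"
          unfolding norm_mult norm_power complex_mod_cnj
          using zr L \<Lambda>[OF k zb] by (intro mult_mono power_mono) auto
        \<comment> \<open>The estimate \<open>cmod (f k z) \<le> \<Lambda> k * \<rho>\<close>
          restores the power of \<open>\<rho>\<close> lost in differentiating
          \<open>cnj z ^ k\<close>. The weights 1 and \<open>k\<close> of the two parts then add up
          to \<open>k + 1\<close>.\<close>
        have "cmod (of_nat k * cnj z ^ (k - 1) * cnj h * f k z)
            \<le> real k * \<rho> ^ (k - 1) * cmod h * (\<Lambda> k * \<rho>)"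
          unfolding norm_mult norm_power complex_mod_cnj norm_of_nat
          using zr L fk[OF k zb] mult_left_mono[OF zr(1) L]
          by (intro mult_mono power_mono) (auto intro: mult_nonneg_nonneg)
        also have "\<dots> = real k * (\<rho> ^ k * (\<Lambda> k * cmod h))"
          using k by (cases k) (auto simp: mult_ac)
        finally show ?thesis
          using 1 by (intro norm_triangle_le) (simp add: algebra_simps)
      qed
      have "{..<m} = insert 0 {1..<m}"
        using m by auto
      then have "D z h - c * h = (deriv (f 0) z - c) * h +
          (\<Sum>k\<in>{1..<m}. cnj z ^ k * (deriv (f k) z * h)
                         + of_nat k * cnj z ^ (k - 1) * cnj h * f k z)"
        by (simp add: D_def algebra_simps)
      also have "cmod \<dots> \<le> A * cmod h + (\<Sum>k\<in>{1..<m}. real (k + 1) * \<rho> ^ k * \<Lambda> k * cmod h)"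
        by (intro norm_triangle_le add_mono sum_norm_le summand)
          (auto simp: norm_mult intro!: mult_right_mono A z)
      finally show "cmod (D z h - c * h)
          \<le> (A + (\<Sum>k\<in>{1..<m}. real (k + 1) * \<rho> ^ k * \<Lambda> k)) * cmod h"
        by (simp add: sum_distrib_right distrib_right)
    qed
  qed (use z12 in auto)
  then show ?thesis
    by (simp add: algebra_simps)
qed

subsection \<open>The root of the lower constant\<close>

lemma Koebe_quotient_mono:
  assumes "0 \<le> r" "r \<le> s" "s < (1::real)"
  shows "(2 * r - r\<^sup>2) / (1 - r)\<^sup>2 \<le> (2 * s - s\<^sup>2) / (1 - s)\<^sup>2"
proof -
  have "r * (1 / (1 - r) + 1 / (1 - r)\<^sup>2) \<le> s * (1 / (1 - s) + 1 / (1 - s)\<^sup>2)"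
    using assms by (intro mult_mono add_mono divide_left_mono power_mono) auto
  then show ?thesis
    using assms by (simp add: Koebe_quotient_eq)
qed

text \<open>Every term of \<open>1 - lower_const m M \<Lambda> r\<close> contains a factor
  \<open>r\<close> times a nondecreasing function, so passing from \<open>s\<close> to
  \<open>r\<close> gains the factor \<open>r / s\<close>. At the root this gives at most
  \<open>r / s < 1\<close>.\<close>

lemma lower_const_pos_before_root:
  assumes M: "M \<ge> 1" and \<Lambda>: "\<And>k. k \<in> {1..<m} \<Longrightarrow> \<Lambda> k \<ge> 0"
    and rs: "0 < r" "r < s" "s < 1" and root: "lower_const m M \<Lambda> s = 0"
  shows "lower_const m M \<Lambda> r > 0"
proof -
  have c: "0 \<le> M - 1 / M"
    using M by (simp add: field_simps) (metis mult_mono' mult_1 zero_le_one)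
  have 1: "(2 * r - r\<^sup>2) / (1 - r)\<^sup>2 \<le> r / s * ((2 * s - s\<^sup>2) / (1 - s)\<^sup>2)"
  proof -
    have "r * (1 / (1 - r) + 1 / (1 - r)\<^sup>2) \<le> r * (1 / (1 - s) + 1 / (1 - s)\<^sup>2)"
      using rs by (intro mult_left_mono add_mono divide_left_mono power_mono) auto
    then show ?thesis
      using rs by (simp add: Koebe_quotient_eq)
  qed
  have 2: "real (k + 1) * r ^ k * \<Lambda> k \<le> r / s * (real (k + 1) * s ^ k * \<Lambda> k)"
    if k: "k \<in> {1..<m}" for k
  proof -
    \<comment> \<open>Since \<open>k \<ge> 1\<close>, one factor \<open>r\<close> can be kept while
      the other \<open>j\<close> factors are enlarged to \<open>s\<close>.\<close>
    obtain j where j: "k = Suc j"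
      using k by (cases k) auto
    have "r ^ k \<le> r * s ^ j"
      using rs by (simp add: j mult_left_mono power_mono)
    also have "\<dots> = r / s * s ^ k"
      using rs by (simp add: j)
    finally have "real (k + 1) * (r ^ k * \<Lambda> k) \<le> real (k + 1) * (r / s * s ^ k * \<Lambda> k)"
      using \<Lambda>[OF k] by (intro mult_left_mono mult_right_mono) auto
    then show ?thesis
      by (simp add: mult_ac)
  qed
  have 3: "(M - 1 / M) * ((2 * r - r\<^sup>2) / (1 - r)\<^sup>2)
      \<le> r / s * ((M - 1 / M) * ((2 * s - s\<^sup>2) / (1 - s)\<^sup>2))"
    using mult_left_mono[OF 1 c] by (simp only: mult.left_commute)
  have 4: "(\<Sum>k\<in>{1..<m}. real (k + 1) * r ^ k * \<Lambda> k)
      \<le> r / s * (\<Sum>k\<in>{1..<m}. real (k + 1) * s ^ k * \<Lambda> k)"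
    unfolding sum_distrib_left by (rule sum_mono) (rule 2)
  have "1 - lower_const m M \<Lambda> r \<le> r / s * (1 - lower_const m M \<Lambda> s)"
    using add_mono[OF 3 4] by (simp only: lower_const_def distrib_left[symmetric]) simp
  also have "\<dots> < 1"
    using root rs by simp
  finally show ?thesis
    by simp
qed

text \<open>Intermediate value theorem from the value 1 at the origin. For \<open>M = 1\<close> the
  function is a polynomial, negative at 1; for \<open>M > 1\<close> it is singular at 1, so an
  interior endpoint is chosen.\<close>

lemma lower_const_root_exists:
  assumes M: "M \<ge> 1" and \<Lambda>: "\<And>k. k \<in> {1..<m} \<Longrightarrow> \<Lambda> k \<ge> 0"
    and "M > 1 \<or> (\<Sum>k\<in>{1..<m}. real (k + 1) * \<Lambda> k) > 1"
  shows "\<exists>r\<in>{0<..<1}. lower_const m M \<Lambda> r = 0"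
proof (cases "M = 1")
  case True
  have eq: "lower_const m M \<Lambda> = (\<lambda>r. 1 - (\<Sum>k\<in>{1..<m}. real (k + 1) * r ^ k * \<Lambda> k))"
    by (simp add: lower_const_def True fun_eq_iff)
  have at0: "lower_const m M \<Lambda> 0 = 1"
    by (simp add: eq power_0_left)
  have at1: "lower_const m M \<Lambda> 1 < 0"
    unfolding eq using assms(3) True by simp
  have "continuous_on {0..1} (lower_const m M \<Lambda>)"
    unfolding eq by (intro continuous_intros)
  then obtain r where "0 \<le> r" "r \<le> 1" "lower_const m M \<Lambda> r = 0"
    using IVT2'[of "lower_const m M \<Lambda>" 1 0 0] at0 at1 by auto
  then show ?thesis
    using at0 at1 by (intro bexI[of _ r]) (auto simp: less_le)
next
  case False
  define c where "c = M - 1 / M"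
  have c: "0 < c"
    using M False less_1_mult[of M M] by (simp add: c_def field_simps)
  \<comment> \<open>With this choice \<open>1 - s = c / (c + 1)\<close>, and the term with
    \<open>c\<close> alone equals \<open>2 + 1 / c\<close>, which already exceeds 1.\<close>
  define s where "s = 1 / (c + 1)"
  have s: "0 < s" "s < 1" "1 - s = c / (c + 1)"
    using c by (auto simp: s_def field_simps)
  have at0: "lower_const m M \<Lambda> 0 = 1"
    by (simp add: lower_const_def power_0_left)
  have "c * ((2 * s - s\<^sup>2) / (1 - s)\<^sup>2) = (2 * c + 1) / c"
  proof -
    have "2 * s - s\<^sup>2 = (2 * c + 1) / (c + 1)\<^sup>2"
    proof -
      have "2 - s = (2 * c + 1) / (c + 1)"
        using c by (simp add: s_def field_simps)
      then have "s * (2 - s) = (2 * c + 1) / (c + 1)\<^sup>2"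
        by (simp add: s_def power2_eq_square)
      then show ?thesis
        by (simp add: power2_eq_square algebra_simps)
    qed
    then show ?thesis
      using c by (simp add: s(3) power2_eq_square)
  qed
  moreover have "(2 * c + 1) / c \<ge> 1"
    using c by (simp add: field_simps)
  moreover have "(\<Sum>k\<in>{1..<m}. real (k + 1) * s ^ k * \<Lambda> k) \<ge> 0"
    using s \<Lambda> by (intro sum_nonneg mult_nonneg_nonneg) auto
  ultimately have ats: "lower_const m M \<Lambda> s \<le> 0"
    by (simp add: lower_const_def c_def[symmetric])
  have "continuous_on {0..s} (lower_const m M \<Lambda>)"
    unfolding lower_const_def using s by (intro continuous_intros) auto
  then obtain r where "0 \<le> r" "r \<le> s" "lower_const m M \<Lambda> r = 0"
    using IVT2'[of "lower_const m M \<Lambda>" s 0 0] at0 ats s by auto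
  then show ?thesis
    using at0 s by (intro bexI[of _ r]) (auto simp: less_le)
qed

text \<open>Existence of the root is conditional: if \<open>M = 1\<close> and the weighted sum of
  the \<open>\<Lambda> k\<close> is at most 1, then \<open>lower_const\<close> stays positive on the
  open interval. Uniqueness and the estimates are stated for any root.\<close>

theorem theorem4p2:
  fixes m :: nat and M :: real and \<Lambda> :: "nat \<Rightarrow> real"
    and F :: "complex \<Rightarrow> complex" and f :: "nat \<Rightarrow> complex \<Rightarrow> complex"
  assumes "m \<ge> 1"
    and "\<And>k. k < m \<Longrightarrow> f k holomorphic_on ball 0 1"
    and "\<And>z. z \<in> ball 0 1 \<Longrightarrow> F z = (\<Sum>k<m. cnj z ^ k * f k z)"
    and "\<And>k. k < m \<Longrightarrow> f k 0 = 0"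
    and "wirtinger_z F 0 = 1"
    and "\<And>z. z \<in> ball 0 1 \<Longrightarrow> cmod (f 0 z) < M"
    and "\<And>k z. k \<in> {1..<m} \<Longrightarrow> z \<in> ball 0 1 \<Longrightarrow> cmod (deriv (f k) z) \<le> \<Lambda> k"
  shows
    "((M > 1 \<or> (\<Sum>k\<in>{1..<m}. real (k + 1) * \<Lambda> k) > 1) \<longrightarrow>
        (\<exists>r2\<in>{0<..<1}. lower_const m M \<Lambda> r2 = 0)) \<and>
     (\<forall>r2\<in>{0<..<1}. lower_const m M \<Lambda> r2 = 0 \<longrightarrow>
        (\<forall>r\<in>{0<..<1}. lower_const m M \<Lambda> r = 0 \<longrightarrow> r = r2) \<and>
        (\<forall>\<rho>2\<in>{0<..<r2}.
           bi_lipschitz_on (cball 0 \<rho>2) F \<and>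
           lower_const m M \<Lambda> \<rho>2 > 0 \<and>
           (\<forall>z1\<in>cball 0 \<rho>2. \<forall>z2\<in>cball 0 \<rho>2.
              lower_const m M \<Lambda> \<rho>2 * cmod (z1 - z2) \<le> cmod (F z1 - F z2) \<and>
              cmod (F z1 - F z2) \<le> upper_const m M \<Lambda> \<rho>2 * cmod (z1 - z2))))"
proof -
  have df0: "deriv (f 0) 0 = 1"
    using wirtinger_z_polyanalytic_0[OF assms(1-4)] assms(5) by simp
  have hol0: "f 0 holomorphic_on ball 0 1" and f00: "f 0 0 = 0"
    using assms(1,2,4) by auto
  have f0M: "cmod (f 0 z) < M" if "cmod z < 1" for z
    using assms(6) that by simp
  have M: "M \<ge> 1"
    by (rule bounded_normalised_ge_1[OF hol0 f00 df0 f0M])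
  have c: "0 \<le> M - 1 / M"
    using M by (simp add: field_simps) (metis mult_mono' mult_1 zero_le_one)
  have \<Lambda>: "\<Lambda> k \<ge> 0" if "k \<in> {1..<m}" for k
    using assms(7)[OF that, of 0] by (auto intro: order_trans[OF norm_ge_zero])
  have pos: "lower_const m M \<Lambda> r > 0"
    if "0 < r" "r < s" "s < 1" "lower_const m M \<Lambda> s = 0" for r s
    by (rule lower_const_pos_before_root[OF M \<Lambda> that])
  have bounds: "lower_const m M \<Lambda> \<rho> * cmod (z1 - z2) \<le> cmod (F z1 - F z2)"
    "cmod (F z1 - F z2) \<le> upper_const m M \<Lambda> \<rho> * cmod (z1 - z2)"
    if \<rho>: "0 < \<rho>" "\<rho> < 1" and z: "z1 \<in> cball 0 \<rho>" "z2 \<in> cball 0 \<rho>" for \<rho> z1 z2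
  proof -
    have lin: "cmod (F z1 - F z2 - c * (z1 - z2)) \<le>
           (A + (\<Sum>k\<in>{1..<m}. real (k + 1) * \<rho> ^ k * \<Lambda> k)) * cmod (z1 - z2)"
      if "\<And>z. z \<in> cball 0 \<rho> \<Longrightarrow> cmod (deriv (f 0) z - c) \<le> A" for c A
      by (rule polyanalytic_linearization_bound[where f = f and F = F and m = m and \<Lambda> = \<Lambda>
            and c = c and A = A and \<rho> = \<rho>]) (fact assms \<rho> that z)+
    have "cmod (deriv (f 0) z - 1) \<le> (M - 1 / M) * ((2 * \<rho> - \<rho>\<^sup>2) / (1 - \<rho>)\<^sup>2)"
      if "z \<in> cball 0 \<rho>" for z
      using that \<rho> c
      by (intro order_trans[OF bounded_normalised_deriv_diff_le[OF hol0 f00 df0 f0M]]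
          mult_left_mono Koebe_quotient_mono) auto
    from lin[OF this] have "cmod (F z1 - F z2 - (z1 - z2)) \<le>
        (1 - lower_const m M \<Lambda> \<rho>) * cmod (z1 - z2)"
      by (simp add: lower_const_def)
    \<comment> \<open>The reverse triangle inequality turns closeness of \<open>F\<close> to the
      identity into a lower bound.\<close>
    moreover have "cmod (z1 - z2) - cmod (F z1 - F z2) \<le> cmod (F z1 - F z2 - (z1 - z2))"
      by (metis norm_minus_commute norm_triangle_ineq2)
    ultimately show "lower_const m M \<Lambda> \<rho> * cmod (z1 - z2) \<le> cmod (F z1 - F z2)"
      by (simp add: algebra_simps)
    have "cmod (deriv (f 0) z - 0) \<le> M / (1 - \<rho>\<^sup>2)" if z: "z \<in> cball 0 \<rho>" for z
    proof -
      have "cmod (deriv (f 0) z) \<le> M / (1 - (cmod z)\<^sup>2)"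
        using z \<rho> by (intro bounded_deriv_le[OF hol0 f0M]) auto
      also have "\<dots> \<le> M / (1 - \<rho>\<^sup>2)"
        using z \<rho> M by (intro frac_le diff_left_mono power_mono) (auto simp: abs_square_less_1)
      finally show ?thesis
        by simp
    qed
    from lin[OF this] show "cmod (F z1 - F z2) \<le> upper_const m M \<Lambda> \<rho> * cmod (z1 - z2)"
      by (simp add: upper_const_def mult_ac)
  qed
  have upper_pos: "upper_const m M \<Lambda> \<rho> > 0" if "0 < \<rho>" "\<rho> < 1" for \<rho>
    unfolding upper_const_def using that M \<Lambda>
    by (intro add_pos_nonneg sum_nonneg divide_pos_pos mult_nonneg_nonneg)
      (auto simp: abs_square_less_1)
  show ?thesis
  proof (intro conjI impI ballI)
    show "\<exists>r2\<in>{0<..<1}. lower_const m M \<Lambda> r2 = 0"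
      if "M > 1 \<or> (\<Sum>k\<in>{1..<m}. real (k + 1) * \<Lambda> k) > 1"
      using lower_const_root_exists[OF M \<Lambda> that] by blast
  next
    fix r2 r assume "r2 \<in> {0<..<1::real}" "lower_const m M \<Lambda> r2 = 0"
      "r \<in> {0<..<1::real}" "lower_const m M \<Lambda> r = 0"
    \<comment> \<open>Of two distinct roots, the smaller would be a point before a root, where
      \<open>lower_const\<close> is positive.\<close>
    then show "r = r2"
      using pos[of r r2] pos[of r2 r] linorder_less_linear[of r r2] by auto
  next
    fix r2 \<rho> assume *: "r2 \<in> {0<..<1::real}" "lower_const m M \<Lambda> r2 = 0" "\<rho> \<in> {0<..<r2}"
    then have \<rho>: "0 < \<rho>" "\<rho> < 1"
      by auto
    show lp: "lower_const m M \<Lambda> \<rho> > 0"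
      using * by (intro pos[of \<rho> r2]) auto
    show "bi_lipschitz_on (cball 0 \<rho>) F"
      unfolding bi_lipschitz_on_def using lp upper_pos[OF \<rho>] bounds[OF \<rho>] by blast
    fix z1 z2 :: complex assume z: "z1 \<in> cball 0 \<rho>" "z2 \<in> cball 0 \<rho>"
    show "lower_const m M \<Lambda> \<rho> * cmod (z1 - z2) \<le> cmod (F z1 - F z2)"
      "cmod (F z1 - F z2) \<le> upper_const m M \<Lambda> \<rho> * cmod (z1 - z2)"
      using bounds[OF \<rho> z] by auto
  qed
qed

end
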